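(* Let $l\ge 1$. For every convex body $K\in\mathcal{K}_{sym}$, $$\frac{\Omega_l^{2+l}(K)}{A^{2-l}(K)}\le 2^{l+2}\pi^{2l},$$ and equality holds if and only if $K$ is an ellipse centered at the origin.
   Context: $\mathcal{K}_{sym}$ denotes the set of compact, strictly convex bodies $K\subset\mathbb{R}^2$, centrally symmetric about the origin, that are smoothly embedded, i.e. whose Gauss parametrization (by the outward unit normal $z=(\cos\theta,\sin\theta)$) is a smooth embedding of $\mathbb{S}^1$; in particular the curvature of the boundary is positive. For $K\in\mathcal{K}_{sym}$, $s$ is the support function and $\kappa=1/(s_{\theta\theta}+s)$ the curvature of $\partial K$, both as functions of the normal angle $\theta\in\mathbb{S}^1$. $A(K)=\frac12\int_{\mathbb{S}^1}\frac{s}{\kappa}\,d\theta$ is the area of $K$, and the $l$-affine length is $\Omega_l(K)=\int_{\mathbb{S}^1}\frac{s}{\kappa}\left(\frac{\kappa}{s^3}\right)^{\frac{l}{l+2}}d\theta$. Here $\Omega_l^{2+l}(K)=(\Omega_l(K))^{2+l}$ and $A^{2-l}(K)=(A(K))^{2-l}$. *)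

theory Defs
  imports "HOL-Analysis.Analysis"
begin

definition unit_normal :: "real \<Rightarrow> real ^ 2" where
  "unit_normal \<theta> = vector [cos \<theta>, sin \<theta>]"

definition smooth_curve :: "(real \<Rightarrow> 'a::real_normed_vector) \<Rightarrow> bool" where
  "smooth_curve f \<longleftrightarrow>
     (\<forall>n. ((\<lambda>g t. vector_derivative g (at t)) ^^ n) f differentiable_on UNIV)"

definition support :: "(real ^ 2) set \<Rightarrow> real \<Rightarrow> real" where
  "support K \<theta> = (SUP x\<in>K. x \<bullet> unit_normal \<theta>)"

definition curvature :: "(real ^ 2) set \<Rightarrow> real \<Rightarrow> real" where
  "curvature K \<theta> = 1 / (deriv (deriv (support K)) \<theta> + support K \<theta>)"

definition strictly_convex_body :: "(real ^ 2) set \<Rightarrow> bool" where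
  "strictly_convex_body K \<longleftrightarrow>
     compact K \<and> convex K \<and> interior K \<noteq> {} \<and>
     (\<forall>x\<in>K. \<forall>y\<in>K. x \<noteq> y \<longrightarrow> open_segment x y \<subseteq> interior K)"

(* X \<theta> is a point of K with outward unit normal unit_normal \<theta>; for a strictly convex
   body it is uniquely determined. *)
definition is_gauss_parametrization :: "(real ^ 2) set \<Rightarrow> (real \<Rightarrow> real ^ 2) \<Rightarrow> bool" where
  "is_gauss_parametrization K X \<longleftrightarrow>
     (\<forall>\<theta>. X \<theta> \<in> K \<and> X \<theta> \<bullet> unit_normal \<theta> = support K \<theta>)"

(* Maps on the circle are represented by 2 pi-periodic maps on the real line. Since the circle
   is compact, a smooth injective immersion of it is an embedding. *)
definition smooth_circle_embedding :: "(real \<Rightarrow> real ^ 2) \<Rightarrow> bool" where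
  "smooth_circle_embedding X \<longleftrightarrow>
     (\<forall>\<theta>. X (\<theta> + 2 * pi) = X \<theta>) \<and>
     smooth_curve X \<and>
     (\<forall>\<theta>. vector_derivative X (at \<theta>) \<noteq> 0) \<and>
     inj_on X {0..<2 * pi}"

definition K_sym :: "(real ^ 2) set set" where
  "K_sym = {K. strictly_convex_body K \<and> (\<forall>x\<in>K. - x \<in> K) \<and>
     (\<exists>X. is_gauss_parametrization K X \<and> smooth_circle_embedding X)}"

definition area :: "(real ^ 2) set \<Rightarrow> real" where
  "area K = 1 / 2 * integral {0..2 * pi} (\<lambda>\<theta>. support K \<theta> / curvature K \<theta>)"

definition affine_length :: "real \<Rightarrow> (real ^ 2) set \<Rightarrow> real" where
  "affine_length l K = integral {0..2 * pi} (\<lambda>\<theta>. support K \<theta> / curvature K \<theta> *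
     (curvature K \<theta> / support K \<theta> ^ 3) powr (l / (l + 2)))"

definition centered_ellipse :: "(real ^ 2) set \<Rightarrow> bool" where
  "centered_ellipse K \<longleftrightarrow> (\<exists>f. linear f \<and> inj f \<and> K = f ` cball (0 :: real ^ 2) 1)"

end

theory Submission
  imports Defs
begin

text \<open>
  Write $s$ for the support function as a function of the normal angle, $w = s/\kappa = s(s+s'')$
  for the density of the cone measure, and $q = l/(l+2) \in [0,1]$. Since
  $w \cdot \kappa/s^3 = s^{-2}$, Hoelder's inequality interpolates the affine length between
  $B = \int w = 2A$ and $T = \int s^{-2}$, which is twice the area of the polar body:
  $\Omega_l \le B^{1-q} T^q$ (\<open>holder_mass\<close>). Raised to the power $l+2$, the right-hand side is
  $B^2 T^l$, so the claim becomes $(BT)^l \le (4\pi^2)^l$, and everything rests on the planar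
  Blaschke--Santalo inequality $BT \le 4\pi^2$ together with its equality case.

  That inequality is proved by a Sturm comparison (\<open>blaschke_santalo\<close>). In the parameter $t$ with
  $dt = s^{-2}\,d\theta$ the functions $y = \sin(\theta-a)/s$ solve the linear equation
  $y_{tt} + \rho y = 0$ with $\rho = s^3(s+s'')$. The symmetry of the body makes $\rho$ periodic with
  period $T/2$, and $y$ vanishes at the ends $\theta = a$ and $\theta = a+\pi$ of one period but not
  in between. Hence 0 is the lowest Dirichlet eigenvalue of $-d^2/dt^2 - \rho$ there,
  and Jacobi's identity shows $\int \varphi_t^2 - \rho\varphi^2\,dt \ge 0$ for every
  $\varphi$ vanishing at both ends. Testing with the sine and the cosine of $2\pi t/T$, each
  over the period that starts at one of its own zeros, and adding, gives
  $(2\pi/T)^2 \cdot T/2 - B/2 \ge 0$. In the case of equality both test functions are multiples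
  of solutions $y$, and $\sin^2 + \cos^2 = 1$ exhibits $s^2$ as a quadratic form in the normal
  vector. This is exactly the form of the support function of a linear image of the disc
  (\<open>centered_ellipse_of_support\<close>).

  Conversely, for an ellipse $\rho$ is constant, so that $\kappa/s^3$ is constant and Hoelder's
  inequality is an equality (\<open>holder_mass_ellipse\<close>); and equality holds in Blaschke--Santalo
  because the solutions $y$ are then pure sine functions of $t$
  (\<open>blaschke_santalo_ellipse\<close>).
\<close>

section \<open>Periodic functions and their antiderivatives\<close>

lemma continuous_real_antiderivative:
  fixes f :: "real \<Rightarrow> real"
  assumes "continuous_on UNIV f"
  obtains F where "\<And>x. (F has_real_derivative f x) (at x)"
proof -
  have "\<exists>F. \<forall>x::real. -\<infinity> < ereal x \<longrightarrow> ereal x < \<infinity> \<longrightarrow> (F has_vector_derivative f x) (at x)"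
    using assms by (intro einterval_antiderivative) (auto simp: continuous_on_eq_continuous_at)
  then show ?thesis
    using that by (auto simp: has_real_derivative_iff_has_vector_derivative)
qed

lemma integral_antiderivative:
  fixes f F :: "real \<Rightarrow> real"
  assumes "\<And>x. (F has_real_derivative f x) (at x)" and "a \<le> b"
  shows "integral {a..b} f = F b - F a"
  using fundamental_theorem_of_calculus[OF assms(2), of F f] assms(1)
  by (intro integral_unique)
     (auto simp: has_real_derivative_iff_has_vector_derivative
           intro: has_vector_derivative_at_within)

lemma antiderivative_of_periodic_shift:
  fixes f F :: "real \<Rightarrow> real"
  assumes F: "\<And>x. (F has_real_derivative f x) (at x)" and per: "\<And>x. f (x + p) = f x"
  shows "F (x + p) = F x + (F p - F 0)"
proof -
  have "((\<lambda>x. F (x + p) - F x) has_real_derivative 0) (at x)" for x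
  proof -
    have "((\<lambda>x. F (x + p)) has_real_derivative f (x + p) * 1) (at x)"
      by (rule DERIV_chain2[OF F]) (auto intro!: derivative_eq_intros)
    from DERIV_diff[OF this F[of x]] show ?thesis
      using per by simp
  qed
  from DERIV_isconst_all[of "\<lambda>x. F (x + p) - F x" x 0] this show ?thesis
    by simp
qed

lemma integral_period_shift:
  fixes f :: "real \<Rightarrow> real"
  assumes "continuous_on UNIV f" and per: "\<And>x. f (x + p) = f x" and "0 \<le> p"
  shows "integral {a..a + p} f = integral {0..p} f"
proof -
  obtain F where F: "\<And>x. (F has_real_derivative f x) (at x)"
    using continuous_real_antiderivative[OF assms(1)] by blast
  show ?thesis
    using antiderivative_of_periodic_shift[OF F per, of a] \<open>0 \<le> p\<close>
    by (simp add: integral_antiderivative[OF F])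
qed

lemma integral_two_periods:
  fixes f :: "real \<Rightarrow> real"
  assumes "continuous_on UNIV f" and per: "\<And>x. f (x + p) = f x" and "0 \<le> p"
  shows "integral {0..2 * p} f = 2 * integral {0..p} f"
proof -
  obtain F where F: "\<And>x. (F has_real_derivative f x) (at x)"
    using continuous_real_antiderivative[OF assms(1)] by blast
  show ?thesis
    using antiderivative_of_periodic_shift[OF F per, of p] \<open>0 \<le> p\<close>
    by (simp add: integral_antiderivative[OF F])
qed

lemma integral_pos_of_continuous_pos:
  fixes f :: "real \<Rightarrow> real"
  assumes "continuous_on UNIV f" and pos: "\<And>x. 0 < f x" and "a < b"
  shows "0 < integral {a..b} f"
proof -
  obtain F where F: "\<And>x. (F has_real_derivative f x) (at x)"
    using continuous_real_antiderivative[OF assms(1)] by blast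
  have "F a < F b"
    using \<open>a < b\<close>
  proof (rule DERIV_pos_imp_increasing)
    show "\<exists>y. (F has_real_derivative y) (at x) \<and> 0 < y" for x
      using F[of x] pos[of x] by (intro exI conjI)
  qed
  then show ?thesis
    using integral_antiderivative[OF F, of a b] \<open>a < b\<close> by simp
qed

lemma periodic_eqI:
  fixes f g :: "real \<Rightarrow> real"
  assumes "\<And>x. f (x + p) = f x" "\<And>x. g (x + p) = g x" "0 < p"
    and eq: "\<And>x. a \<le> x \<Longrightarrow> x < a + p \<Longrightarrow> f x = g x"
  shows "f = g"
proof
  fix x
  interpret f: periodic_fun_simple f p by unfold_locales fact
  interpret g: periodic_fun_simple g p by unfold_locales fact
  define n where "n = \<lfloor>(x - a) / p\<rfloor>"
  have "of_int n \<le> (x - a) / p" "(x - a) / p < of_int n + 1"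
    unfolding n_def by linarith+
  then have "a \<le> x - of_int n * p" "x - of_int n * p < a + p"
    using \<open>0 < p\<close> by (auto simp: field_simps)
  from eq[OF this] show "f x = g x"
    by (simp add: f.minus_of_int g.minus_of_int)
qed

lemma tendsto_ratio_at_common_zero:
  fixes f g :: "real \<Rightarrow> real"
  assumes f: "(f has_real_derivative f') (at a)" and g: "(g has_real_derivative g') (at a)"
    and "f a = 0" "g a = 0" "g' \<noteq> 0"
  shows "((\<lambda>x. f x / g x) \<longlongrightarrow> f' / g') (at a)"
proof -
  have "((\<lambda>x. ((f x - f a) / (x - a)) / ((g x - g a) / (x - a))) \<longlongrightarrow> f' / g') (at a)"
    using f g \<open>g' \<noteq> 0\<close> by (intro tendsto_divide) (auto simp: has_field_derivative_iff)
  moreover have "eventually (\<lambda>x. ((f x - f a) / (x - a)) / ((g x - g a) / (x - a)) = f x / g x) (at a)"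
    using assms by (auto simp: eventually_at_filter)
  ultimately show ?thesis
    by (rule Lim_transform_eventually)
qed

lemma sin_shift_nonzero:
  fixes x a :: real
  assumes "a < x" "x < a + pi"
  shows "sin (x - a) \<noteq> 0"
  using sin_gt_zero[of "x - a"] assms by auto

section \<open>Comparing phases along a symmetric support function\<close>

text \<open>
  The analytic content of membership in \<^const>\<open>K_sym\<close>: \<open>s\<close> is a support function, \<open>s1\<close> and \<open>s2\<close>
  are its derivatives, the period \<open>\<pi>\<close> is the central symmetry of the body, and \<open>s + s2\<close> is
  the radius of curvature.
\<close>

locale sym_support =
  fixes s s1 s2 :: "real \<Rightarrow> real"
  assumes pos: "0 < s x"
    and deriv_s: "(s has_real_derivative s1 x) (at x)"
    and deriv_s1: "(s1 has_real_derivative s2 x) (at x)"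
    and cont_s2: "continuous_on UNIV s2"
    and period: "s (x + pi) = s x"
    and curv_radius_pos: "0 < s x + s2 x"
begin

lemma s_nonzero [simp]: "s x \<noteq> 0"
  using pos[of x] by simp

lemma cont_s: "continuous_on A s"
  using deriv_s by (meson DERIV_isCont continuous_at_imp_continuous_on)

lemma cont_s1: "continuous_on A s1"
  using deriv_s1 by (meson DERIV_isCont continuous_at_imp_continuous_on)

lemma cont_s2': "continuous_on A s2"
  using cont_s2 continuous_on_subset by blast

lemmas s_continuous = cont_s cont_s1 cont_s2'

lemma period_s1: "s1 (x + pi) = s1 x"
proof -
  have "((\<lambda>x. s (x + pi)) has_real_derivative s1 (x + pi) * 1) (at x)"
    by (rule DERIV_chain2[OF deriv_s]) (auto intro!: derivative_eq_intros)
  then show ?thesis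
    using DERIV_unique[OF _ deriv_s[of x]] by (simp add: period)
qed

lemma period_s2: "s2 (x + pi) = s2 x"
proof -
  have "((\<lambda>x. s1 (x + pi)) has_real_derivative s2 (x + pi) * 1) (at x)"
    by (rule DERIV_chain2[OF deriv_s1]) (auto intro!: derivative_eq_intros)
  then show ?thesis
    using DERIV_unique[OF _ deriv_s1[of x]] by (simp add: period_s1)
qed

text \<open>
  In the parameter $t$ with $dt = dx/s^2$, let $\varphi = \sin\Phi$ and $y = \sin(x-a)/s$. The
  function below is $(\varphi_t - \varphi\, y_t/y)/s$; its square, integrated against $dx$, is the
  remainder $\int (\varphi_t - \varphi\, y_t/y)^2\,dt$ in Jacobi's identity. Away from the zeros of
  $y$ it vanishes exactly where the ratio $\varphi/y$ is stationary.
\<close>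

definition phase_ratio_deriv :: "real \<Rightarrow> (real \<Rightarrow> real) \<Rightarrow> real \<Rightarrow> real \<Rightarrow> real" where
  "phase_ratio_deriv c \<Phi> a x =
     c * cos (\<Phi> x) / s x + sin (\<Phi> x) * (s1 x - s x * cos (x - a) / sin (x - a))"

lemma phase_ratio_has_derivative:
  assumes "(\<Phi> has_real_derivative c / (s x)\<^sup>2) (at x)" "sin (x - a) \<noteq> 0"
  shows "((\<lambda>x. sin (\<Phi> x) * s x / sin (x - a)) has_real_derivative
           phase_ratio_deriv c \<Phi> a x / sin (x - a)) (at x)"
  using assms(2)
  by (auto intro!: derivative_eq_intros assms deriv_s deriv_s1
      simp: phase_ratio_deriv_def divide_simps power2_eq_square)
     (simp add: algebra_simps)

text \<open>
  With $r = y_t/y$ the equation $y_{tt} + \rho y = 0$ becomes the Riccati equation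
  $r_t = -\rho - r^2$, whence
  $(\varphi^2 r)_t = \varphi_t^2 - \rho\varphi^2 - (\varphi_t - \varphi r)^2$. The statement is this
  identity multiplied by $dt/dx = s^{-2}$.
\<close>

lemma jacobi_identity:
  assumes \<Phi>: "(\<Phi> has_real_derivative c / (s x)\<^sup>2) (at x)" and nz: "sin (x - a) \<noteq> 0"
  shows "((\<lambda>x. (sin (\<Phi> x))\<^sup>2 * s x * (s x * cos (x - a) / sin (x - a) - s1 x)) has_real_derivative
           c\<^sup>2 * (cos (\<Phi> x))\<^sup>2 / (s x)\<^sup>2 - s x * (s x + s2 x) * (sin (\<Phi> x))\<^sup>2
             - (phase_ratio_deriv c \<Phi> a x)\<^sup>2) (at x)"
proof -
  define S C u k where "S = sin (\<Phi> x)" and "C = cos (\<Phi> x)" and "u = sin (x - a)" and "k = cos (x - a)"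
  have u: "u \<noteq> 0"
    using nz by (simp add: u_def)
  have "((\<lambda>x. (sin (\<Phi> x))\<^sup>2 * s x * (s x * cos (x - a) / sin (x - a) - s1 x)) has_real_derivative
      2 * S * (C * (c / (s x)\<^sup>2)) * s x * (s x * (k / u) - s1 x) + S\<^sup>2 * s1 x * (s x * (k / u) - s1 x)
      + S\<^sup>2 * s x * (s1 x * (k / u) + s x * ((- u * u - k * k) / (u * u)) - s2 x)) (at x)"
    using u unfolding S_def C_def u_def k_def
    by (auto intro!: derivative_eq_intros \<Phi> deriv_s deriv_s1 simp: power2_eq_square)
       (simp add: field_simps)
  also have "(- u * u - k * k) / (u * u) = - 1 - (k / u)\<^sup>2"
    using u by (simp add: field_simps power2_eq_square)
  also have "2 * S * (C * (c / (s x)\<^sup>2)) * s x * (s x * (k / u) - s1 x) + S\<^sup>2 * s1 x * (s x * (k / u) - s1 x)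
      + S\<^sup>2 * s x * (s1 x * (k / u) + s x * (- 1 - (k / u)\<^sup>2) - s2 x) =
      c\<^sup>2 * C\<^sup>2 / (s x)\<^sup>2 - s x * (s x + s2 x) * S\<^sup>2 - (c * C / s x + S * (s1 x - s x * (k / u)))\<^sup>2"
  proof -
    have "2 * S * (C * (c / (s x)\<^sup>2)) * s x * (s x * m - s1 x) + S\<^sup>2 * s1 x * (s x * m - s1 x)
      + S\<^sup>2 * s x * (s1 x * m + s x * (- 1 - m\<^sup>2) - s2 x) =
      c\<^sup>2 * C\<^sup>2 / (s x)\<^sup>2 - s x * (s x + s2 x) * S\<^sup>2 - (c * C / s x + S * (s1 x - s x * m))\<^sup>2" for m
      by (simp add: field_simps power2_eq_square)
    then show ?thesis .
  qed
  finally show ?thesis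
    by (simp add: phase_ratio_deriv_def S_def C_def u_def k_def)
qed

text \<open>
  At a common zero of $\varphi$ and $y$ the pole of $y_t/y$ is simple while $\varphi^2$ vanishes to
  second order, so the boundary term of Jacobi's identity tends to 0.
\<close>

lemma tendsto_boundary_term:
  assumes \<Phi>: "(\<Phi> has_real_derivative c / (s e)\<^sup>2) (at e)"
    and "sin (\<Phi> e) = 0" "sin (e - a) = 0"
  shows "((\<lambda>x. (sin (\<Phi> x))\<^sup>2 * s x * (s x * cos (x - a) / sin (x - a) - s1 x)) \<longlongrightarrow> 0) (at e)"
proof -
  have cos: "cos (e - a) \<noteq> 0"
    using assms(3) by (metis sin_cos_squared_add zero_neq_one add_0 power_zero_numeral)
  have "((\<lambda>x. sin (\<Phi> x) / sin (x - a)) \<longlongrightarrow> cos (\<Phi> e) * (c / (s e)\<^sup>2) / cos (e - a)) (at e)"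
    using assms cos
    by (intro tendsto_ratio_at_common_zero) (auto intro!: derivative_eq_intros \<Phi>)
  moreover have "((\<lambda>x. sin (\<Phi> x)) \<longlongrightarrow> sin (\<Phi> e)) (at e)"
    using \<Phi>[THEN DERIV_isCont] by (auto intro!: tendsto_intros simp: isCont_def)
  moreover have "(s \<longlongrightarrow> s e) (at e)" "(s1 \<longlongrightarrow> s1 e) (at e)"
    using deriv_s[THEN DERIV_isCont] deriv_s1[THEN DERIV_isCont] by (auto simp: isCont_def)
  ultimately have "((\<lambda>x. s x * (sin (\<Phi> x) * (s x * cos (x - a) * (sin (\<Phi> x) / sin (x - a))
       - sin (\<Phi> x) * s1 x))) \<longlongrightarrow> s e * (sin (\<Phi> e) * (s e * cos (e - a) *
       (cos (\<Phi> e) * (c / (s e)\<^sup>2) / cos (e - a)) - sin (\<Phi> e) * s1 e))) (at e)"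
    by (intro tendsto_mult tendsto_diff tendsto_cos tendsto_ident_at tendsto_const)
  then show ?thesis
    using assms(2) by (simp add: algebra_simps power2_eq_square)
qed

text \<open>
  The boundary terms vanish, so the quadratic form $\int \varphi_t^2 - \rho\varphi^2\,dt$ of a
  test function vanishing at \<open>a\<close> and \<open>a + \<pi>\<close> is the integral of a square; in particular it
  is nonnegative.
\<close>

lemma wirtinger_identity:
  assumes \<Phi>: "\<And>x. (\<Phi> has_real_derivative c / (s x)\<^sup>2) (at x)"
    and ends: "sin (\<Phi> a) = 0" "sin (\<Phi> (a + pi)) = 0"
  shows "((\<lambda>x. (phase_ratio_deriv c \<Phi> a x)\<^sup>2) has_integral
          integral {a..a + pi} (\<lambda>x. c\<^sup>2 * (cos (\<Phi> x))\<^sup>2 / (s x)\<^sup>2 - s x * (s x + s2 x) * (sin (\<Phi> x))\<^sup>2))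
          {a..a + pi}"
proof -
  let ?h = "\<lambda>x. c\<^sup>2 * (cos (\<Phi> x))\<^sup>2 / (s x)\<^sup>2 - s x * (s x + s2 x) * (sin (\<Phi> x))\<^sup>2"
  let ?G = "\<lambda>x. (sin (\<Phi> x))\<^sup>2 * s x * (s x * cos (x - a) / sin (x - a) - s1 x)"
  have contPhi: "continuous_on A \<Phi>" for A
    using \<Phi> by (meson DERIV_isCont continuous_at_imp_continuous_on)
  have h: "(?h has_integral integral {a..a + pi} ?h) {a..a + pi}"
    by (intro integrable_integral integrable_continuous_real continuous_intros s_continuous contPhi) auto
  have "isCont ?G x" if "x \<in> {a..a + pi}" for x
  proof (cases "x = a \<or> x = a + pi")
    case True
    with tendsto_boundary_term[OF \<Phi>, of x a] ends show ?thesis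
      by (auto simp: isCont_def)
  next
    case False
    with that show ?thesis
      by (intro jacobi_identity[OF \<Phi>, THEN DERIV_isCont] sin_shift_nonzero) auto
  qed
  then have "continuous_on {a..a + pi} ?G"
    by (intro continuous_at_imp_continuous_on) auto
  then have "((\<lambda>x. ?h x - (phase_ratio_deriv c \<Phi> a x)\<^sup>2) has_integral ?G (a + pi) - ?G a) {a..a + pi}"
    by (intro fundamental_theorem_of_calculus_interior)
       (auto simp: has_real_derivative_iff_has_vector_derivative[symmetric]
             intro!: jacobi_identity[OF \<Phi>] dest: sin_shift_nonzero)
  from has_integral_diff[OF h this] ends show ?thesis
    by simp
qed

text \<open>
  The remainder need not be continuous at the endpoints, where $y_t/y$ has its poles; hence its
  pointwise vanishing is deduced on compact subintervals. Then $\varphi/y$ has derivative zero.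
\<close>

lemma phase_proportional:
  assumes \<Phi>: "\<And>x. (\<Phi> has_real_derivative c / (s x)\<^sup>2) (at x)"
    and zero: "((\<lambda>x. (phase_ratio_deriv c \<Phi> a x)\<^sup>2) has_integral 0) {a..a + pi}"
  obtains k where "\<And>x. a < x \<Longrightarrow> x < a + pi \<Longrightarrow> sin (\<Phi> x) * s x = k * sin (x - a)"
proof -
  let ?E = "\<lambda>x. (phase_ratio_deriv c \<Phi> a x)\<^sup>2"
  have contPhi: "continuous_on A \<Phi>" for A
    using \<Phi> by (meson DERIV_isCont continuous_at_imp_continuous_on)
  have E0: "phase_ratio_deriv c \<Phi> a x = 0" if x: "a < x" "x < a + pi" for x
  proof -
    define u v where "u = (a + x) / 2" and "v = (x + (a + pi)) / 2"
    have uv: "a < u" "u < x" "x < v" "v < a + pi"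
      using x by (auto simp: u_def v_def)
    have "sin (y - a) \<noteq> 0" if "y \<in> {u..v}" for y
      using uv that by (intro sin_shift_nonzero) auto
    then have cont: "continuous_on {u..v} ?E"
      unfolding phase_ratio_deriv_def by (intro continuous_intros s_continuous contPhi) auto
    then have int: "(?E has_integral integral {u..v} ?E) {u..v}"
      by (intro integrable_integral integrable_continuous_real)
    have "integral {u..v} ?E \<le> 0"
      using uv by (intro has_integral_subset_le[OF _ int zero]) auto
    moreover have "0 \<le> integral {u..v} ?E"
      by (rule has_integral_nonneg[OF int]) auto
    ultimately have "integral {u..v} ?E = 0"
      by simp
    then have "?E x = 0"
      using has_integral_0_cbox_imp_0[of u v ?E x] cont int uv by (auto simp: box_real)
    then show ?thesis by simp
  qed
  have "((\<lambda>x. sin (\<Phi> x) * s x / sin (x - a)) has_field_derivative 0) (at x within {a<..<a + pi})"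
    if "x \<in> {a<..<a + pi}" for x
    using phase_ratio_has_derivative[OF \<Phi> sin_shift_nonzero, of a x] E0[of x] that
    by (auto intro: has_field_derivative_at_within)
  from has_field_derivative_zero_constant[OF _ this]
  obtain k where "\<forall>x\<in>{a<..<a + pi}. sin (\<Phi> x) * s x / sin (x - a) = k"
    by (auto simp: convex_real_interval)
  with that[of k] show ?thesis
    by (auto simp: divide_eq_eq sin_shift_nonzero)
qed

lemma s_pi: "s pi = s 0"
  using period[of 0] by simp

section \<open>The Blaschke--Santalo inequality\<close>

text \<open>
  Twice the area of the body: the integral of the distance $s$ from the origin to the tangent line
  with respect to the arc length $d\theta/\kappa$, which adds up cones over pieces of the boundary.
\<close>

definition cone_mass :: real where
  "cone_mass = integral {0..2 * pi} (\<lambda>x. s x * (s x + s2 x))"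

text \<open>
  Twice the area of the polar body, whose radial function is $1/s$.
\<close>

definition polar_mass :: real where
  "polar_mass = integral {0..2 * pi} (\<lambda>x. 1 / (s x)\<^sup>2)"

lemma cone_mass_half: "cone_mass = 2 * integral {0..pi} (\<lambda>x. s x * (s x + s2 x))"
  unfolding cone_mass_def
  by (intro integral_two_periods continuous_intros s_continuous) (auto simp: period period_s2)

lemma cone_mass_pos: "0 < cone_mass"
  unfolding cone_mass_def
  by (intro integral_pos_of_continuous_pos continuous_intros s_continuous) (auto simp: pos curv_radius_pos)

lemma polar_continuous: "continuous_on A (\<lambda>x. 1 / (s x)\<^sup>2)"
  by (intro continuous_intros s_continuous) auto

lemma polar_mass_pos: "0 < polar_mass"
  unfolding polar_mass_def by (intro integral_pos_of_continuous_pos polar_continuous) auto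

lemma polar_mass_half: "polar_mass = 2 * integral {0..pi} (\<lambda>x. 1 / (s x)\<^sup>2)"
  unfolding polar_mass_def by (intro integral_two_periods polar_continuous) (auto simp: period)

lemma polar_primitive:
  obtains P where "\<And>x. (P has_real_derivative 1 / (s x)\<^sup>2) (at x)"
    and "P 0 = 0" and "\<And>x. P (x + pi) = P x + polar_mass / 2"
proof -
  obtain P0 where P0: "\<And>x. (P0 has_real_derivative 1 / (s x)\<^sup>2) (at x)"
    using continuous_real_antiderivative[OF polar_continuous] by blast
  define P where "P x = P0 x - P0 0" for x
  have P: "(P has_real_derivative 1 / (s x)\<^sup>2) (at x)" for x
    unfolding P_def by (auto intro!: derivative_eq_intros P0)
  moreover have "P (x + pi) = P x + polar_mass / 2" for x
    using antiderivative_of_periodic_shift[OF P, of pi x] polar_mass_half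
      integral_antiderivative[OF P, of 0 pi]
    by (simp add: period)
  moreover have "P 0 = 0"
    by (simp add: P_def)
  ultimately show ?thesis
    using that by blast
qed

text \<open>
  The two test functions vanish at different points, but over a half turn the integral of a
  $\pi$-periodic function does not depend on the starting point. So the two quadratic forms can be
  added over the same interval, where $\sin^2 + \cos^2 = 1$ removes the test functions altogether.
\<close>

theorem blaschke_santalo:
  shows "cone_mass * polar_mass \<le> 4 * pi\<^sup>2"
    and "cone_mass * polar_mass = 4 * pi\<^sup>2 \<Longrightarrow>
      \<exists>a b k m. \<forall>x. (s x)\<^sup>2 = (k * sin (x - a))\<^sup>2 + (m * sin (x - b))\<^sup>2"
proof -
  obtain P where P: "\<And>x. (P has_real_derivative 1 / (s x)\<^sup>2) (at x)"
    and P0: "P 0 = 0" and Pper: "\<And>x. P (x + pi) = P x + polar_mass / 2"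
    using polar_primitive by blast
  \<comment> \<open>This normalization makes the phase advance by exactly \<open>\<pi>\<close> over a half turn, so a sine that
      vanishes at \<open>a\<close> also vanishes at \<open>a + \<pi>\<close>.\<close>
  define c where "c = 2 * pi / polar_mass"
  define \<Phi> where "\<Phi> x = c * P x" for x
  have d\<Phi>: "(\<Phi> has_real_derivative c / (s x)\<^sup>2) (at x)" for x
    unfolding \<Phi>_def using DERIV_cmult[OF P[of x], of c] by simp
  have \<Phi>per: "\<Phi> (x + pi) = \<Phi> x + pi" for x
    unfolding \<Phi>_def Pper using polar_mass_pos by (simp add: c_def field_simps)
  have cont\<Phi>: "continuous_on A \<Phi>" for A
    using d\<Phi> by (meson DERIV_isCont continuous_at_imp_continuous_on)
  have \<Phi>0: "\<Phi> 0 = 0"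
    by (simp add: \<Phi>_def P0)
  obtain b where b: "\<Phi> b = pi / 2"
    using IVT'[of \<Phi> 0 "pi / 2" pi] cont\<Phi> \<Phi>0 \<Phi>per[of 0] by auto
  \<comment> \<open>The cosine of the phase \<open>\<Phi>\<close> is, up to sign, the sine of \<open>\<Psi>\<close>, and its zero \<open>b\<close> serves as
      the start of its own half turn.\<close>
  define \<Psi> where "\<Psi> x = \<Phi> x - pi / 2" for x
  have d\<Psi>: "(\<Psi> has_real_derivative c / (s x)\<^sup>2) (at x)" for x
    unfolding \<Psi>_def by (auto intro!: derivative_eq_intros d\<Phi>)
  have \<Psi>per: "\<Psi> (x + pi) = \<Psi> x + pi" for x
    by (simp add: \<Psi>_def \<Phi>per)
  have cont\<Psi>: "continuous_on A \<Psi>" for A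
    unfolding \<Psi>_def by (intro continuous_intros cont\<Phi>)
  have \<Psi>b: "\<Psi> b = 0"
    by (simp add: \<Psi>_def b)
  define h where "h \<phi> x = c\<^sup>2 * (cos (\<phi> x))\<^sup>2 / (s x)\<^sup>2 - s x * (s x + s2 x) * (sin (\<phi> x))\<^sup>2"
    for \<phi> :: "real \<Rightarrow> real" and x
  have E\<Phi>: "((\<lambda>x. (phase_ratio_deriv c \<Phi> 0 x)\<^sup>2) has_integral integral {0..0 + pi} (h \<Phi>)) {0..0 + pi}"
    unfolding h_def using \<Phi>0 \<Phi>per[of 0] by (intro wirtinger_identity d\<Phi>) auto
  have E\<Psi>: "((\<lambda>x. (phase_ratio_deriv c \<Psi> b x)\<^sup>2) has_integral integral {b..b + pi} (h \<Psi>)) {b..b + pi}"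
    unfolding h_def using \<Psi>b \<Psi>per[of b] by (intro wirtinger_identity d\<Psi>) auto
  have "continuous_on A (h \<Phi>)" "continuous_on A (h \<Psi>)" for A
    unfolding h_def by (intro continuous_intros s_continuous cont\<Phi> cont\<Psi>; simp)+
  note hcont = this
  have "integral {b..b + pi} (h \<Psi>) = integral {0..pi} (h \<Psi>)"
    by (intro integral_period_shift hcont) (auto simp: h_def period period_s2 \<Psi>per)
  then have "integral {0..0 + pi} (h \<Phi>) + integral {b..b + pi} (h \<Psi>)
      = integral {0..pi} (\<lambda>x. h \<Phi> x + h \<Psi> x)"
    by (simp add: integral_add integrable_continuous_real hcont)
  also have "(\<lambda>x. h \<Phi> x + h \<Psi> x) = (\<lambda>x. c\<^sup>2 * (1 / (s x)\<^sup>2) - s x * (s x + s2 x))"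
  proof
    fix x
    have "(cos (\<Psi> x))\<^sup>2 = (sin (\<Phi> x))\<^sup>2" "(sin (\<Psi> x))\<^sup>2 = (cos (\<Phi> x))\<^sup>2"
      by (simp_all add: \<Psi>_def cos_diff sin_diff)
    then have "h \<Phi> x + h \<Psi> x = c\<^sup>2 * ((cos (\<Phi> x))\<^sup>2 + (sin (\<Phi> x))\<^sup>2) / (s x)\<^sup>2
        - s x * (s x + s2 x) * ((sin (\<Phi> x))\<^sup>2 + (cos (\<Phi> x))\<^sup>2)"
      unfolding h_def by (simp only: ring_distribs add_divide_distrib)
    then show "h \<Phi> x + h \<Psi> x = c\<^sup>2 * (1 / (s x)\<^sup>2) - s x * (s x + s2 x)"
      by simp
  qed
  also have "integral {0..pi} (\<lambda>x. c\<^sup>2 * (1 / (s x)\<^sup>2) - s x * (s x + s2 x))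
      = integral {0..pi} (\<lambda>x. c\<^sup>2 * (1 / (s x)\<^sup>2)) - integral {0..pi} (\<lambda>x. s x * (s x + s2 x))"
    by (intro integral_diff integrable_continuous_real continuous_intros s_continuous) auto
  also have "\<dots> = c\<^sup>2 * (polar_mass / 2) - cone_mass / 2"
    unfolding integral_mult_right polar_mass_half cone_mass_half by simp
  also have "\<dots> = (4 * pi\<^sup>2 - cone_mass * polar_mass) / (2 * polar_mass)"
    using polar_mass_pos by (simp add: c_def field_simps power2_eq_square)
  finally have sum: "integral {0..0 + pi} (h \<Phi>) + integral {b..b + pi} (h \<Psi>)
      = (4 * pi\<^sup>2 - cone_mass * polar_mass) / (2 * polar_mass)" .
  have nonneg: "0 \<le> integral {0..0 + pi} (h \<Phi>)" "0 \<le> integral {b..b + pi} (h \<Psi>)"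
    using E\<Phi> E\<Psi> by (auto intro: has_integral_nonneg)
  with sum have "0 \<le> (4 * pi\<^sup>2 - cone_mass * polar_mass) / (2 * polar_mass)"
    by linarith
  then show "cone_mass * polar_mass \<le> 4 * pi\<^sup>2"
    using polar_mass_pos by (simp add: zero_le_divide_iff)
  assume "cone_mass * polar_mass = 4 * pi\<^sup>2"
  with sum nonneg have "integral {0..0 + pi} (h \<Phi>) = 0" "integral {b..b + pi} (h \<Psi>) = 0"
    by auto
  note zero = E\<Phi>[unfolded this] E\<Psi>[unfolded this]
  obtain k where k: "\<And>x. 0 < x \<Longrightarrow> x < 0 + pi \<Longrightarrow> sin (\<Phi> x) * s x = k * sin (x - 0)"
    using phase_proportional[OF d\<Phi> zero(1)] by blast
  obtain m where m: "\<And>x. b < x \<Longrightarrow> x < b + pi \<Longrightarrow> sin (\<Psi> x) * s x = m * sin (x - b)"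
    using phase_proportional[OF d\<Psi> zero(2)] by blast
  \<comment> \<open>Squaring removes the sign change of the sines over a half turn, so both relations extend
      periodically to all angles.\<close>
  have K: "(\<lambda>x. (sin (\<Phi> x) * s x)\<^sup>2) = (\<lambda>x. (k * sin (x - 0))\<^sup>2)"
  proof (rule periodic_eqI[where p = pi and a = 0])
    show "(sin (\<Phi> x) * s x)\<^sup>2 = (k * sin (x - 0))\<^sup>2" if "0 \<le> x" "x < 0 + pi" for x
      using k[of x] that \<Phi>0 by (cases "x = 0") auto
  qed (auto simp: \<Phi>per period)
  have M: "(\<lambda>x. (sin (\<Psi> x) * s x)\<^sup>2) = (\<lambda>x. (m * sin (x - b))\<^sup>2)"
  proof (rule periodic_eqI[where p = pi and a = b])
    show "(sin (\<Psi> x) * s x)\<^sup>2 = (m * sin (x - b))\<^sup>2" if "b \<le> x" "x < b + pi" for x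
      using m[of x] that \<Psi>b by (cases "x = b") auto
    show "(m * sin (x + pi - b))\<^sup>2 = (m * sin (x - b))\<^sup>2" for x
      using sin_periodic_pi[of "x - b"] by (simp add: algebra_simps power_mult_distrib)
  qed (auto simp: \<Psi>per period)
  have "(s x)\<^sup>2 = (sin (\<Phi> x) * s x)\<^sup>2 + (sin (\<Psi> x) * s x)\<^sup>2" for x
  proof -
    have "(sin (\<Psi> x))\<^sup>2 = (cos (\<Phi> x))\<^sup>2"
      by (simp add: \<Psi>_def sin_diff)
    then have "(sin (\<Phi> x) * s x)\<^sup>2 + (sin (\<Psi> x) * s x)\<^sup>2 = ((sin (\<Phi> x))\<^sup>2 + (cos (\<Phi> x))\<^sup>2) * (s x)\<^sup>2"
      by (simp only: power_mult_distrib ring_distribs)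
    then show ?thesis by simp
  qed
  then have "(s x)\<^sup>2 = (k * sin (x - 0))\<^sup>2 + (m * sin (x - b))\<^sup>2" for x
    using fun_cong[OF K, of x] fun_cong[OF M, of x] by simp
  then show "\<exists>a b k m. \<forall>x. (s x)\<^sup>2 = (k * sin (x - a))\<^sup>2 + (m * sin (x - b))\<^sup>2"
    by blast
qed

text \<open>
  For an ellipse, $s^2$ is a quadratic form $Q$ in the normal vector. Differentiating
  $s^2 = Q$ twice gives $s s' = Q'/2$ and $s'^2 + s s'' = Q''/2$, and
  $s^3(s+s'') = Q\,(Q + Q''/2) - (Q'/2)^2$ turns out to be the determinant of the form.
\<close>

lemma quadratic_support:
  assumes Q: "\<And>x. (s x)\<^sup>2 = \<alpha> * (cos x)\<^sup>2 + 2 * \<beta> * cos x * sin x + \<gamma> * (sin x)\<^sup>2"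
  shows "s x * s1 x = (\<gamma> - \<alpha>) * cos x * sin x + \<beta> * ((cos x)\<^sup>2 - (sin x)\<^sup>2)" (is ?first)
    and "(s x) ^ 3 * (s x + s2 x) = \<alpha> * \<gamma> - \<beta>\<^sup>2" (is ?second)
proof -
  have first: "s x * s1 x = (\<gamma> - \<alpha>) * cos x * sin x + \<beta> * ((cos x)\<^sup>2 - (sin x)\<^sup>2)" for x
  proof -
    have "((\<lambda>x. (s x)\<^sup>2) has_real_derivative 2 * (s x * s1 x)) (at x)"
      by (auto intro!: derivative_eq_intros deriv_s)
    moreover have "((\<lambda>x. (s x)\<^sup>2) has_real_derivative
        2 * ((\<gamma> - \<alpha>) * cos x * sin x + \<beta> * ((cos x)\<^sup>2 - (sin x)\<^sup>2))) (at x)"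
      unfolding Q by (auto intro!: derivative_eq_intros simp: algebra_simps power2_eq_square)
    ultimately have "2 * (s x * s1 x) = 2 * ((\<gamma> - \<alpha>) * cos x * sin x + \<beta> * ((cos x)\<^sup>2 - (sin x)\<^sup>2))"
      by (rule DERIV_unique)
    then show ?thesis by simp
  qed
  then show ?first .
  have second: "(s1 x)\<^sup>2 + s x * s2 x = (\<gamma> - \<alpha>) * ((cos x)\<^sup>2 - (sin x)\<^sup>2) - 4 * \<beta> * cos x * sin x"
  proof -
    have "((\<lambda>x. s x * s1 x) has_real_derivative (s1 x)\<^sup>2 + s x * s2 x) (at x)"
      by (auto intro!: derivative_eq_intros deriv_s deriv_s1 simp: power2_eq_square)
    moreover have "((\<lambda>x. s x * s1 x) has_real_derivative
        (\<gamma> - \<alpha>) * ((cos x)\<^sup>2 - (sin x)\<^sup>2) - 4 * \<beta> * cos x * sin x) (at x)"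
      unfolding first by (auto intro!: derivative_eq_intros simp: algebra_simps power2_eq_square)
    ultimately show ?thesis
      by (rule DERIV_unique)
  qed
  have "(s x) ^ 3 * (s x + s2 x) = (s x)\<^sup>2 * ((s x)\<^sup>2 + ((s1 x)\<^sup>2 + s x * s2 x)) - (s x * s1 x)\<^sup>2"
    by algebra
  also have "\<dots> = (\<alpha> * \<gamma> - \<beta>\<^sup>2) * ((sin x)\<^sup>2 + (cos x)\<^sup>2)\<^sup>2"
    unfolding Q first second
      by (simp add: algebra_simps power2_eq_square
          del: sin_cos_squared_add sin_cos_squared_add2 sin_cos_squared_add3)
  finally show ?second by simp
qed

lemma cone_mass_quadratic_support:
  assumes Q: "\<And>x. (s x)\<^sup>2 = \<alpha> * (cos x)\<^sup>2 + 2 * \<beta> * cos x * sin x + \<gamma> * (sin x)\<^sup>2"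
  shows "0 < \<alpha> * \<gamma> - \<beta>\<^sup>2" and "cone_mass = (\<alpha> * \<gamma> - \<beta>\<^sup>2) * polar_mass"
proof -
  define D where "D = \<alpha> * \<gamma> - \<beta>\<^sup>2"
  have D: "(s x) ^ 3 * (s x + s2 x) = D" for x
    unfolding D_def by (rule quadratic_support(2)[OF Q])
  show "0 < \<alpha> * \<gamma> - \<beta>\<^sup>2"
    unfolding D_def[symmetric] D[of 0, symmetric] by (simp add: pos curv_radius_pos)
  have "s x * (s x + s2 x) = D * (1 / (s x)\<^sup>2)" for x
    using D[of x] by (simp add: field_simps power2_eq_square power3_eq_cube)
  then show "cone_mass = (\<alpha> * \<gamma> - \<beta>\<^sup>2) * polar_mass"
    unfolding cone_mass_def polar_mass_def D_def[symmetric] integral_mult_right[symmetric] by simp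
qed

text \<open>
  Let $D$ be the determinant of the form, so that $B = DT$ and the claim reads $\sqrt D\,T = 2\pi$.
  The number $\sqrt D\,T/2$ is the angle through which a vector turning with angular speed
  $\sqrt D/s^2$ moves during a half turn of the normal. The vector $(\alpha\cos x + \beta\sin x,
  \sqrt D \sin x)$ turns with just this speed and is reversed by the half turn, so the angle is an odd
  multiple of \<open>\<pi>\<close>. It is at most \<open>\<pi>\<close> by the inequality $BT \le 4\pi^2$.
\<close>

theorem blaschke_santalo_ellipse:
  assumes Q: "\<And>x. (s x)\<^sup>2 = \<alpha> * (cos x)\<^sup>2 + 2 * \<beta> * cos x * sin x + \<gamma> * (sin x)\<^sup>2"
  shows "cone_mass * polar_mass = 4 * pi\<^sup>2"
proof -
  obtain P where P: "\<And>x. (P has_real_derivative 1 / (s x)\<^sup>2) (at x)"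
    and P0: "P 0 = 0" and Pper: "\<And>x. P (x + pi) = P x + polar_mass / 2"
    using polar_primitive by blast
  define D where "D = \<alpha> * \<gamma> - \<beta>\<^sup>2"
  define d where "d = sqrt D"
  have mass: "cone_mass = D * polar_mass"
    unfolding D_def by (rule cone_mass_quadratic_support(2)[OF Q])
  have d: "0 < d" "d\<^sup>2 = D"
    using cone_mass_quadratic_support(1)[OF Q] by (simp_all add: d_def D_def)
  have \<alpha>: "\<alpha> = (s 0)\<^sup>2"
    using Q[of 0] by simp
  define \<psi> where "\<psi> x = d * P x" for x
  \<comment> \<open>Up to the factor \<open>s 0\<close>, this is the cosine of the angle between the turning vector,
      whose length is \<open>s 0 * s x\<close>, and the direction with polar angle \<open>\<psi> x\<close>.\<close>
  define U where "U x = ((\<alpha> * cos x + \<beta> * sin x) * cos (\<psi> x) + d * sin x * sin (\<psi> x)) / s x" for x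
  have d\<psi>: "(\<psi> has_real_derivative d / (s x)\<^sup>2) (at x)" for x
    unfolding \<psi>_def using DERIV_cmult[OF P[of x], of d] by simp
  have "(U has_real_derivative 0) (at x)" for x
  proof -
    let ?p = "\<alpha> * cos x + \<beta> * sin x" and ?p' = "\<beta> * cos x - \<alpha> * sin x"
    note ss1 = quadratic_support(1)[OF Q, of x]
    \<comment> \<open>With the factor \<open>sin\<^sup>2 + cos\<^sup>2\<close> both sides are homogeneous of degree 3, and the equations
        are polynomial identities.\<close>
    have "?p' * (s x)\<^sup>2 + d\<^sup>2 * sin x * ((sin x)\<^sup>2 + (cos x)\<^sup>2) = ?p * (s x * s1 x)"
      unfolding ss1 Q d(2) D_def
      by (simp add: algebra_simps power2_eq_square
          del: sin_cos_squared_add sin_cos_squared_add2 sin_cos_squared_add3)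
    moreover have "cos x * (s x)\<^sup>2 - ?p * ((sin x)\<^sup>2 + (cos x)\<^sup>2) = sin x * (s x * s1 x)"
      unfolding ss1 Q
      by (simp add: algebra_simps power2_eq_square
          del: sin_cos_squared_add sin_cos_squared_add2 sin_cos_squared_add3)
    ultimately have eqs: "?p' * (s x)\<^sup>2 + d\<^sup>2 * sin x = ?p * (s x * s1 x)"
        "cos x * (s x)\<^sup>2 - ?p = sin x * (s x * s1 x)"
      by simp_all
    have "(?p' * (s x)\<^sup>2 + d\<^sup>2 * sin x) * cos (\<psi> x) + d * (cos x * (s x)\<^sup>2 - ?p) * sin (\<psi> x)
        - (?p * cos (\<psi> x) + d * sin x * sin (\<psi> x)) * (s x * s1 x) = 0"
      unfolding eqs by (simp add: algebra_simps)
    moreover have "(U has_real_derivative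
        ((?p' * (s x)\<^sup>2 + d\<^sup>2 * sin x) * cos (\<psi> x) + d * (cos x * (s x)\<^sup>2 - ?p) * sin (\<psi> x)
        - (?p * cos (\<psi> x) + d * sin x * sin (\<psi> x)) * (s x * s1 x)) / (s x) ^ 3) (at x)"
      unfolding U_def
      by (auto intro!: derivative_eq_intros d\<psi> deriv_s)
         (simp add: field_simps power2_eq_square power3_eq_cube)
    ultimately show ?thesis by simp
  qed
  then have "U pi = U 0"
    by (intro DERIV_isconst_all) auto
  then have "\<alpha> * (cos (\<psi> pi) + 1) = 0"
    by (simp add: U_def s_pi \<psi>_def P0 field_simps)
  then have "cos (\<psi> pi) = - 1"
    using \<alpha> by (simp add: add_eq_0_iff)
  have \<psi>pi: "\<psi> pi = d * (polar_mass / 2)"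
    using Pper[of 0] by (simp add: \<psi>_def P0)
  have "(\<psi> pi)\<^sup>2 \<le> pi\<^sup>2"
    using blaschke_santalo(1)
    by (simp add: \<psi>pi power_mult_distrib power_divide d(2) mass mult.assoc
        power2_eq_square[of polar_mass])
  then have "\<psi> pi \<le> pi"
    by (rule power2_le_imp_le) simp
  have "\<psi> pi = pi"
  proof (rule cos_inj_pi)
    show "0 \<le> \<psi> pi"
      using d(1) polar_mass_pos by (simp add: \<psi>pi)
  qed (use \<open>\<psi> pi \<le> pi\<close> \<open>cos (\<psi> pi) = - 1\<close> in simp_all)
  then have "(d * (polar_mass / 2))\<^sup>2 = pi\<^sup>2"
    by (simp add: \<psi>pi)
  then show ?thesis
    by (simp add: power_mult_distrib power_divide d(2) mass mult.assoc
        power2_eq_square[of polar_mass])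
qed

section \<open>Interpolation between area and polar area\<close>

text \<open>
  Hoelder's inequality for the exponents $1/(1-q)$ and $1/q$: the integrand is
  $w^{1-q}\,(s^{-2})^q$ with $w = s(s+s'')$. After $w$ and $s^{-2}$ are normalized to have integral
  1, it follows from Young's inequality applied pointwise.
\<close>

lemma holder_mass:
  assumes "0 \<le> q" "q \<le> 1"
  shows "integral {0..2 * pi} (\<lambda>x. s x * (s x + s2 x) * (1 / ((s x + s2 x) * s x ^ 3)) powr q)
    \<le> cone_mass powr (1 - q) * polar_mass powr q"
proof -
  let ?w = "\<lambda>x. s x * (s x + s2 x)"
  define B T where "B = cone_mass" and "T = polar_mass"
  have B: "0 < B" and T: "0 < T"
    unfolding B_def T_def by (rule cone_mass_pos polar_mass_pos)+
  have snz: "s x + s2 x \<noteq> 0" for x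
    using curv_radius_pos[of x] by simp
  have pw: "?w x * (1 / ((s x + s2 x) * s x ^ 3)) powr q
      \<le> B powr (1 - q) * T powr q * ((1 - q) * (?w x / B) + q * (1 / (s x)\<^sup>2 / T))" for x
  proof -
    have w: "0 < ?w x"
      by (simp add: pos curv_radius_pos)
    have "(1 / ((s x + s2 x) * s x ^ 3)) = (1 / (s x)\<^sup>2) / ?w x"
      using snz by (simp add: field_simps power2_eq_square power3_eq_cube)
    then have "?w x * (1 / ((s x + s2 x) * s x ^ 3)) powr q = ?w x * ((1 / (s x)\<^sup>2) powr q / ?w x powr q)"
      by (simp only: powr_divide)
    also have "\<dots> = ?w x powr (1 - q) * (1 / (s x)\<^sup>2) powr q"
      using w by (simp add: powr_diff)
    also have "\<dots> = B powr (1 - q) * T powr q * ((?w x / B) powr (1 - q) * (1 / (s x)\<^sup>2 / T) powr q)"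
    proof -
      have "(?w x / B) powr (1 - q) = ?w x powr (1 - q) / B powr (1 - q)"
        "(1 / (s x)\<^sup>2 / T) powr q = (1 / (s x)\<^sup>2) powr q / T powr q"
        by (rule powr_divide)+
      then show ?thesis
        using B T by simp
    qed
    also have "\<dots> \<le> B powr (1 - q) * T powr q * ((1 - q) * (?w x / B) + q * (1 / (s x)\<^sup>2 / T))"
      using assms w B T by (intro mult_left_mono Youngs_inequality_0) (auto simp: pos)
    finally show ?thesis .
  qed
  have "integral {0..2 * pi} (\<lambda>x. ?w x * (1 / ((s x + s2 x) * s x ^ 3)) powr q)
      \<le> integral {0..2 * pi} (\<lambda>x. B powr (1 - q) * T powr q * ((1 - q) * (?w x / B) + q * (1 / (s x)\<^sup>2 / T)))"
  proof (rule integral_le)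
    show "(\<lambda>x. ?w x * (1 / ((s x + s2 x) * s x ^ 3)) powr q) integrable_on {0..2 * pi}"
      using snz by (intro integrable_continuous_real continuous_intros s_continuous) auto
    show "(\<lambda>x. B powr (1 - q) * T powr q * ((1 - q) * (?w x / B) + q * (1 / (s x)\<^sup>2 / T)))
        integrable_on {0..2 * pi}"
      using B T by (intro integrable_continuous_real continuous_intros s_continuous) auto
  qed (rule pw)
  also have "\<dots> = B powr (1 - q) * T powr q * (integral {0..2 * pi} (\<lambda>x. (1 - q) * (?w x / B))
      + integral {0..2 * pi} (\<lambda>x. q * (1 / (s x)\<^sup>2 / T)))"
    using B T
    by (subst integral_mult_right, subst integral_add)
       (auto intro!: integrable_continuous_real continuous_intros s_continuous)
  also have "integral {0..2 * pi} (\<lambda>x. (1 - q) * (?w x / B)) = 1 - q"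
    using B by (simp add: B_def cone_mass_def)
  also have "integral {0..2 * pi} (\<lambda>x. q * (1 / (s x)\<^sup>2 / T)) = q"
    unfolding integral_mult_right integral_divide using T by (simp add: T_def polar_mass_def)
  finally show ?thesis
    by (simp add: B_def T_def)
qed

text \<open>
  The two functions $w$ and $s^{-2}$ are proportional for an ellipse, which is the equality case of
  Hoelder's inequality.
\<close>

lemma holder_mass_ellipse:
  assumes Q: "\<And>x. (s x)\<^sup>2 = \<alpha> * (cos x)\<^sup>2 + 2 * \<beta> * cos x * sin x + \<gamma> * (sin x)\<^sup>2"
  shows "integral {0..2 * pi} (\<lambda>x. s x * (s x + s2 x) * (1 / ((s x + s2 x) * s x ^ 3)) powr q)
    = cone_mass powr (1 - q) * polar_mass powr q"
proof -
  define D where "D = \<alpha> * \<gamma> - \<beta>\<^sup>2"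
  have D: "(s x) ^ 3 * (s x + s2 x) = D" for x
    unfolding D_def by (rule quadratic_support(2)[OF Q])
  have "0 < D" "cone_mass = D * polar_mass"
    unfolding D_def by (rule cone_mass_quadratic_support[OF Q])+
  have "1 / ((s x + s2 x) * s x ^ 3) = 1 / D" for x
    using D[of x] by (simp add: mult.commute)
  then have "integral {0..2 * pi} (\<lambda>x. s x * (s x + s2 x) * (1 / ((s x + s2 x) * s x ^ 3)) powr q)
      = cone_mass * (1 / D) powr q"
    unfolding cone_mass_def by (simp only: integral_mult_left)
  then show ?thesis
    using \<open>0 < D\<close> \<open>cone_mass = D * polar_mass\<close> polar_mass_pos
    by (simp add: powr_mult powr_divide powr_diff)
qed

end

section \<open>Support functions\<close>

lemma inner_unit_normal: "x \<bullet> unit_normal \<theta> = x $ 1 * cos \<theta> + x $ 2 * sin \<theta>"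
  by (simp add: unit_normal_def inner_vec_def sum_2)

lemma inner_unit_normals: "unit_normal a \<bullet> unit_normal b = cos (b - a)"
  unfolding inner_unit_normal by (simp add: unit_normal_def cos_diff mult.commute)

lemma polar_coordinates:
  fixes w :: "real ^ 2"
  obtains \<theta> where "w = norm w *\<^sub>R unit_normal \<theta>"
proof (cases "w = 0")
  case False
  have "(w $ 1 / norm w)\<^sup>2 + (w $ 2 / norm w)\<^sup>2 = ((w $ 1)\<^sup>2 + (w $ 2)\<^sup>2) / (norm w)\<^sup>2"
    by (simp add: power_divide add_divide_distrib)
  also have "(w $ 1)\<^sup>2 + (w $ 2)\<^sup>2 = (norm w)\<^sup>2"
    unfolding power2_norm_eq_inner by (simp add: inner_vec_def sum_2 power2_eq_square)
  finally have "(w $ 1 / norm w)\<^sup>2 + (w $ 2 / norm w)\<^sup>2 = 1"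
    using False by simp
  from this obtain t where "w $ 1 / norm w = cos t" "w $ 2 / norm w = sin t"
    by (rule sincos_total_2pi)
  then have "w $ 1 = norm w * cos t" "w $ 2 = norm w * sin t"
    using False by (simp_all add: nonzero_divide_eq_eq mult.commute)
  then have "w = norm w *\<^sub>R unit_normal t"
    unfolding vec_eq_iff forall_2 by (simp add: unit_normal_def)
  then show ?thesis by (rule that)
next
  case True
  then have "w = norm w *\<^sub>R unit_normal 0" by simp
  then show ?thesis by (rule that)
qed

lemma inner_le_support:
  assumes "compact K" "x \<in> K"
  shows "x \<bullet> unit_normal \<theta> \<le> support K \<theta>"
  unfolding support_def
proof (rule cSUP_upper)
  have "compact ((\<lambda>x. x \<bullet> unit_normal \<theta>) ` K)"
    using assms by (intro compact_continuous_image continuous_intros)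
  then show "bdd_above ((\<lambda>x. x \<bullet> unit_normal \<theta>) ` K)"
    by (simp add: compact_imp_bounded bounded_imp_bdd_above)
qed fact

text \<open>
  A point outside \<open>K\<close> is cut off by a line; the unit normal of that line is a direction in which
  \<open>K\<close> extends less far than the point. In particular a convex body is determined by its
  support function.
\<close>

lemma subset_of_support_le:
  assumes "compact K" "convex K" "K \<noteq> {}" "compact L"
    and le: "\<And>\<theta>. support L \<theta> \<le> support K \<theta>"
  shows "L \<subseteq> K"
proof
  fix z assume "z \<in> L"
  show "z \<in> K"
  proof (rule ccontr)
    assume "z \<notin> K"
    then obtain a b where ab: "a \<bullet> z < b" "\<And>x. x \<in> K \<Longrightarrow> b < a \<bullet> x"
      using separating_hyperplane_closed_point[of K z] assms by (auto simp: compact_imp_closed)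
    obtain \<theta> where \<theta>: "- a = norm (- a) *\<^sub>R unit_normal \<theta>"
      by (rule polar_coordinates)
    have inner: "a \<bullet> x = - (norm a * (x \<bullet> unit_normal \<theta>))" for x
      using arg_cong[OF \<theta>, of "\<lambda>w. x \<bullet> w"] by (simp add: inner_commute[of a x])
    have "a \<noteq> 0"
    proof
      assume "a = 0"
      moreover obtain x where "x \<in> K"
        using \<open>K \<noteq> {}\<close> by blast
      ultimately show False
        using ab(1) ab(2)[of x] by simp
    qed
    then have "norm a * support K \<theta> \<le> - b"
    proof -
      have "x \<bullet> unit_normal \<theta> \<le> - b / norm a" if "x \<in> K" for x
        using ab(2)[OF that] \<open>a \<noteq> 0\<close> inner[of x] by (simp add: field_simps)
      then have "support K \<theta> \<le> - b / norm a"
        unfolding support_def using \<open>K \<noteq> {}\<close> by (intro cSUP_least)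
      then show ?thesis
        using \<open>a \<noteq> 0\<close> by (simp add: field_simps)
    qed
    moreover have "norm a * (z \<bullet> unit_normal \<theta>) \<le> norm a * support K \<theta>"
      using inner_le_support[OF \<open>compact L\<close> \<open>z \<in> L\<close>, of \<theta>] le[of \<theta>]
      by (intro mult_left_mono) auto
    ultimately show False
      using ab(1) inner[of z] by simp
  qed
qed

text \<open>
  Here \<open>w\<close> is the image of the normal under the adjoint of \<open>f\<close>.
\<close>

lemma support_linear_image_cball:
  fixes f :: "real ^ 2 \<Rightarrow> real ^ 2"
  assumes "\<And>y. f y \<bullet> unit_normal \<theta> = y \<bullet> w"
  shows "support (f ` cball 0 1) \<theta> = norm w"
proof -
  have "support (f ` cball 0 1) \<theta> = (SUP y\<in>cball 0 1. y \<bullet> w)"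
    by (simp add: support_def image_image assms)
  also have "\<dots> = norm w"
  proof (rule cSup_eq_maximum)
    have "w /\<^sub>R norm w \<in> cball 0 1" "norm w = (w /\<^sub>R norm w) \<bullet> w"
      by (cases "w = 0"; simp add: dot_square_norm power2_eq_square)+
    then show "norm w \<in> (\<lambda>y. y \<bullet> w) ` cball 0 1"
      by blast
    fix r assume "r \<in> (\<lambda>y. y \<bullet> w) ` cball 0 1"
    then obtain y where y: "norm y \<le> 1" "r = y \<bullet> w"
      by auto
    have "y \<bullet> w \<le> norm y * norm w"
      by (rule norm_cauchy_schwarz)
    also have "\<dots> \<le> 1 * norm w"
      using y by (intro mult_right_mono) auto
    finally show "r \<le> norm w"
      using y by simp
  qed
  finally show ?thesis .
qed

section \<open>Regularity of the bodies and ellipses\<close>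

text \<open>
  For fixed \<open>\<theta>\<close> the function $t \mapsto s(t) - X(\theta)\cdot n(t)$ is nonnegative and vanishes at
  \<open>\<theta>\<close>, so its derivative vanishes there: the velocity $X'$ is tangential, $s' = X\cdot n'$ and
  $s + s'' = X'\cdot n'$. This number is nonzero because $X$ is an immersion, and nonnegative
  because the outward normal is a monotone function of the boundary point:
  $(X(t) - X(\theta))\cdot(n(t) - n(\theta)) \ge 0$.
\<close>

lemma K_sym_sym_support:
  assumes "K \<in> K_sym"
  shows "sym_support (support K) (deriv (support K)) (deriv (deriv (support K)))"
proof -
  let ?S = "support K"
  from assms obtain X where
    body: "compact K" "convex K" "interior K \<noteq> {}" and sym: "\<And>x. x \<in> K \<Longrightarrow> - x \<in> K" and
    X: "\<And>\<theta>. X \<theta> \<in> K" "\<And>\<theta>. X \<theta> \<bullet> unit_normal \<theta> = ?S \<theta>" and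
    smooth: "smooth_curve X" and immersed: "\<And>\<theta>. vector_derivative X (at \<theta>) \<noteq> 0"
    unfolding K_sym_def strictly_convex_body_def is_gauss_parametrization_def
      smooth_circle_embedding_def by blast
  note le = inner_le_support[OF body(1)]
  define V where "V \<theta> = vector_derivative X (at \<theta>)" for \<theta>
  have diff: "X differentiable_on UNIV" "V differentiable_on UNIV"
    using smooth[unfolded smooth_curve_def, rule_format, of 0]
      smooth[unfolded smooth_curve_def, rule_format, of 1] by (auto simp: V_def[abs_def])
  have contV: "continuous_on UNIV V"
    using diff(2) by (rule differentiable_imp_continuous_on)
  have dX: "(X has_vector_derivative V \<theta>) (at \<theta>)" for \<theta>
    using diff(1) by (simp add: V_def differentiable_on_def vector_derivative_works[symmetric])
  have dXi: "((\<lambda>\<theta>. X \<theta> $ i) has_real_derivative V \<theta> $ i) (at \<theta>)" for i \<theta>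
    using bounded_linear.has_vector_derivative[OF bounded_linear_vec_nth dX]
    by (simp add: has_real_derivative_iff_has_vector_derivative)
  have S: "?S = (\<lambda>\<theta>. X \<theta> $ 1 * cos \<theta> + X \<theta> $ 2 * sin \<theta>)"
    using X(2) by (auto simp: inner_unit_normal)
  have tangent: "V \<theta> $ 1 * cos \<theta> + V \<theta> $ 2 * sin \<theta> = 0" for \<theta>
  proof -
    let ?f = "\<lambda>t. ?S t - (X \<theta> $ 1 * cos t + X \<theta> $ 2 * sin t)"
    have "(?f has_real_derivative V \<theta> $ 1 * cos \<theta> + V \<theta> $ 2 * sin \<theta>) (at \<theta>)"
      unfolding S by (auto intro!: derivative_eq_intros dXi)
    moreover have "?f \<theta> \<le> ?f t" for t
      using le[OF X(1), of \<theta> t] X(2)[of \<theta>] by (simp add: inner_unit_normal)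
    ultimately show ?thesis
      by (intro DERIV_local_min[of ?f _ \<theta> 1]) simp_all
  qed
  define S1 where "S1 \<theta> = X \<theta> $ 2 * cos \<theta> - X \<theta> $ 1 * sin \<theta>" for \<theta>
  \<comment> \<open>The component of the velocity along the unit tangent, which is the radius of curvature.\<close>
  define \<rho> where "\<rho> \<theta> = V \<theta> $ 2 * cos \<theta> - V \<theta> $ 1 * sin \<theta>" for \<theta>
  have dS: "(?S has_real_derivative S1 \<theta>) (at \<theta>)" for \<theta>
    unfolding S S1_def using tangent[of \<theta>]
    by (auto intro!: derivative_eq_intros dXi simp: algebra_simps)
  have dS1: "(S1 has_real_derivative \<rho> \<theta> - ?S \<theta>) (at \<theta>)" for \<theta>
    unfolding S S1_def \<rho>_def
    by (auto intro!: derivative_eq_intros dXi simp: algebra_simps)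
  have derivs: "deriv ?S = S1" "deriv S1 = (\<lambda>\<theta>. \<rho> \<theta> - ?S \<theta>)"
    using dS dS1 by (auto intro!: DERIV_imp_deriv)
  have "0 \<le> \<rho> \<theta>" for \<theta>
  proof -
    let ?q = "\<lambda>g t. (g t - g \<theta>) / (t - \<theta>) :: real"
    have "((\<lambda>t. ?q (\<lambda>t. X t $ 1) t * ?q cos t + ?q (\<lambda>t. X t $ 2) t * ?q sin t) \<longlongrightarrow>
        V \<theta> $ 1 * (- sin \<theta>) + V \<theta> $ 2 * cos \<theta>) (at \<theta>)"
      using dXi[of 1 \<theta>] dXi[of 2 \<theta>] DERIV_cos[of \<theta>] DERIV_sin[of \<theta>]
      unfolding has_field_derivative_iff by (intro tendsto_intros)
    moreover have "0 \<le> ?q (\<lambda>t. X t $ 1) t * ?q cos t + ?q (\<lambda>t. X t $ 2) t * ?q sin t" for t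
    proof -
      have "0 \<le> (X t $ 1 - X \<theta> $ 1) * (cos t - cos \<theta>) + (X t $ 2 - X \<theta> $ 2) * (sin t - sin \<theta>)"
        using le[OF X(1), of \<theta> t] le[OF X(1), of t \<theta>] X(2)[of \<theta>, symmetric] X(2)[of t, symmetric]
        by (simp add: inner_unit_normal algebra_simps)
      then have "0 \<le> ((X t $ 1 - X \<theta> $ 1) * (cos t - cos \<theta>) + (X t $ 2 - X \<theta> $ 2) * (sin t - sin \<theta>))
          / ((t - \<theta>) * (t - \<theta>))"
        by (rule divide_nonneg_nonneg) simp
      then show ?thesis
        by (simp add: add_divide_distrib)
    qed
    ultimately show ?thesis
      unfolding \<rho>_def by (intro tendsto_lowerbound[of _ _ "at \<theta>" 0]) (auto simp: algebra_simps)
  qed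
  moreover have "\<rho> \<theta> \<noteq> 0" for \<theta>
  proof
    assume "\<rho> \<theta> = 0"
    moreover have "(\<rho> \<theta>)\<^sup>2 + (V \<theta> $ 1 * cos \<theta> + V \<theta> $ 2 * sin \<theta>)\<^sup>2
        = ((V \<theta> $ 1)\<^sup>2 + (V \<theta> $ 2)\<^sup>2) * ((sin \<theta>)\<^sup>2 + (cos \<theta>)\<^sup>2)"
      unfolding \<rho>_def by (simp add: power2_eq_square algebra_simps
          del: sin_cos_squared_add sin_cos_squared_add2 sin_cos_squared_add3)
    ultimately have "(V \<theta> $ 1)\<^sup>2 + (V \<theta> $ 2)\<^sup>2 = 0"
      using tangent[of \<theta>] by simp
    then have "V \<theta> = 0"
      by (simp add: vec_eq_iff forall_2 sum_power2_eq_zero_iff)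
    with immersed show False
      by (simp add: V_def)
  qed
  ultimately have \<rho>: "0 < \<rho> \<theta>" for \<theta>
    by (simp add: order.strict_iff_order)
  have S_le: "?S (\<theta> + pi) \<le> ?S \<theta>" "?S \<theta> \<le> ?S (\<theta> + pi)" for \<theta>
    using le[OF sym[OF X(1)], of "\<theta> + pi" \<theta>] le[OF sym[OF X(1)], of \<theta> "\<theta> + pi"]
      X(2)[of \<theta>] X(2)[of "\<theta> + pi"] by (auto simp: inner_unit_normal)
  \<comment> \<open>A ball in \<open>K\<close> reaches further in direction of the normal than its centre \<open>x\<close>, and the
      mirror image \<open>- x\<close> also lies in \<open>K\<close>.\<close>
  have "0 < ?S \<theta>" for \<theta>
  proof -
    obtain x r where r: "0 < r" "cball x r \<subseteq> K"
      using body(3) by (meson ex_in_conv mem_interior_cball)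
    have "norm (unit_normal \<theta>) = 1"
      by (simp add: norm_eq_1 inner_unit_normals)
    then have "x + r *\<^sub>R unit_normal \<theta> \<in> K" "x \<in> K"
      using r by (auto simp: subset_iff dist_norm)
    from le[OF this(1), of \<theta>] le[OF sym[OF this(2)], of \<theta>] show ?thesis
      using r by (simp add: inner_add_left inner_unit_normals)
  qed
  then show ?thesis
  proof (unfold_locales)
    show "continuous_on UNIV (deriv (deriv ?S))"
      unfolding derivs \<rho>_def
      using DERIV_continuous_on[of UNIV ?S S1] dS
      by (intro continuous_intros contV) (auto intro: has_field_derivative_at_within)
  qed (use dS dS1 \<rho> S_le in \<open>auto simp: derivs intro: antisym\<close>)
qed

lemma centered_ellipse_support:
  assumes "centered_ellipse K"
  shows "\<exists>\<alpha> \<beta> \<gamma>. \<forall>x. (support K x)\<^sup>2 = \<alpha> * (cos x)\<^sup>2 + 2 * \<beta> * cos x * sin x + \<gamma> * (sin x)\<^sup>2"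
proof -
  obtain f where f: "linear f" "K = f ` cball (0 :: real ^ 2) 1"
    using assms unfolding centered_ellipse_def by blast
  define u v where "u = adjoint f (axis 1 1)" and "v = adjoint f (axis 2 1)"
  have u: "f y $ 1 = y \<bullet> u" and v: "f y $ 2 = y \<bullet> v" for y
    using adjoint_works[OF f(1)] by (simp_all add: u_def v_def inner_axis)
  have supp: "support K x = norm (cos x *\<^sub>R u + sin x *\<^sub>R v)" for x
    unfolding f(2) by (rule support_linear_image_cball) (simp add: inner_unit_normal u v inner_add_right)
  have "(support K x)\<^sup>2 = (u \<bullet> u) * (cos x)\<^sup>2 + 2 * (u \<bullet> v) * cos x * sin x + (v \<bullet> v) * (sin x)\<^sup>2" for x
    unfolding supp power2_norm_eq_inner
    by (simp add: inner_add_left inner_add_right inner_commute power2_eq_square algebra_simps)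
  then show ?thesis by blast
qed

text \<open>
  The form $(k \sin(x-a))^2 + (m \sin(x-b))^2$ is the squared length of the image of the normal
  under a linear map; the adjoint \<open>f\<close> of that map sends the unit disc to a body with the same
  support function. Were \<open>f\<close> singular, the support function would vanish at \<open>a\<close> or at \<open>b\<close>.
\<close>

lemma centered_ellipse_of_support:
  assumes "compact K" "convex K" "K \<noteq> {}" and pos: "\<And>x. 0 < support K x"
    and eq: "\<And>x. (support K x)\<^sup>2 = (k * sin (x - a))\<^sup>2 + (m * sin (x - b))\<^sup>2"
  shows "centered_ellipse K"
proof -
  define f :: "real ^ 2 \<Rightarrow> real ^ 2" where
    "f y = (k * y $ 1) *\<^sub>R unit_normal (a + pi / 2) + (m * y $ 2) *\<^sub>R unit_normal (b + pi / 2)" for y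
  have "linear f"
    by (rule linearI) (simp_all add: f_def algebra_simps)
  have shift: "cos (x - (c + pi / 2)) = sin (x - c)" for x c :: real
    by (simp add: diff_diff_eq[symmetric] cos_diff[of "x - c"])
  have f_inner: "f y \<bullet> unit_normal x = k * y $ 1 * sin (x - a) + m * y $ 2 * sin (x - b)" for x y
    by (simp add: f_def inner_add_left inner_unit_normals shift)
  have "inj f"
    unfolding linear_injective_0[OF \<open>linear f\<close>]
  proof (intro allI impI)
    fix y assume "f y = 0"
    then have "m * y $ 2 * sin (a - b) = 0" "k * y $ 1 * sin (b - a) = 0"
      using f_inner[of y a] f_inner[of y b] by auto
    moreover have "m * sin (a - b) \<noteq> 0" "k * sin (b - a) \<noteq> 0"
      using eq[of a] eq[of b] pos[of a] pos[of b] by auto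
    ultimately show "y = 0"
      by (simp add: vec_eq_iff forall_2)
  qed
  have supp: "support (f ` cball 0 1) x = support K x" for x
  proof -
    have "support (f ` cball 0 1) x = norm (vector [k * sin (x - a), m * sin (x - b)] :: real ^ 2)"
      by (rule support_linear_image_cball) (simp only: f_inner, simp add: inner_vec_def sum_2 algebra_simps)
    also have "\<dots> = sqrt ((support K x)\<^sup>2)"
      unfolding eq by (simp add: norm_eq_sqrt_inner inner_vec_def sum_2 power2_eq_square)
    finally show ?thesis
      using pos[of x] by simp
  qed
  have "compact (f ` cball 0 1)" "convex (f ` cball 0 1)"
    using \<open>linear f\<close> by (auto intro!: compact_continuous_image convex_linear_image
        linear_continuous_on simp: linear_conv_bounded_linear)
  then have "K = f ` cball 0 1"
    using assms by (intro antisym subset_of_support_le) (auto simp: supp)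
  with \<open>linear f\<close> \<open>inj f\<close> show ?thesis
    unfolding centered_ellipse_def by blast
qed

section \<open>The affine isoperimetric inequality\<close>

theorem theorem6p3:
  fixes l :: real and K :: "(real ^ 2) set"
  assumes "l \<ge> 1" and "K \<in> K_sym"
  shows "affine_length l K powr (2 + l) / area K powr (2 - l)
           \<le> 2 powr (l + 2) * pi powr (2 * l) \<and>
         (affine_length l K powr (2 + l) / area K powr (2 - l)
           = 2 powr (l + 2) * pi powr (2 * l) \<longleftrightarrow> centered_ellipse K)"
proof -
  interpret sym_support "support K" "deriv (support K)" "deriv (deriv (support K))"
    using assms(2) by (rule K_sym_sym_support)
  define q where "q = l / (l + 2)"
  define M where "M = cone_mass powr (1 - q) * polar_mass powr q"
  have B: "0 < cone_mass" and T: "0 < polar_mass"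
    by (rule cone_mass_pos polar_mass_pos)+
  have q: "0 \<le> q" "q \<le> 1" "(1 - q) * (2 + l) = 2" "q * (2 + l) = l"
    using assms(1) by (auto simp: q_def field_simps)
  have area: "area K = cone_mass / 2"
    unfolding area_def curvature_def cone_mass_def by (simp add: add.commute)
  have \<Omega>: "affine_length l K = integral {0..2 * pi} (\<lambda>x. support K x *
      (support K x + deriv (deriv (support K)) x) *
      (1 / ((support K x + deriv (deriv (support K)) x) * support K x ^ 3)) powr q)"
    unfolding affine_length_def curvature_def q_def by (simp add: add.commute)
  have \<Omega>_le: "affine_length l K \<le> M"
    unfolding \<Omega> M_def using q by (intro holder_mass)
  have \<Omega>_nonneg: "0 \<le> affine_length l K"
    unfolding \<Omega>
  proof (rule integral_nonneg)
    have "support K x \<noteq> 0 \<and> support K x + deriv (deriv (support K)) x \<noteq> 0" for x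
      using curv_radius_pos[of x] by simp
    then show "(\<lambda>x. support K x * (support K x + deriv (deriv (support K)) x) *
        (1 / ((support K x + deriv (deriv (support K)) x) * support K x ^ 3)) powr q)
        integrable_on {0..2 * pi}"
      by (intro integrable_continuous_real continuous_intros s_continuous) auto
  qed (simp add: less_imp_le pos curv_radius_pos)
  have bound: "M powr (2 + l) / area K powr (2 - l) = 2 powr (2 - l) * (cone_mass * polar_mass) powr l"
  proof -
    have "M powr (2 + l) = cone_mass powr 2 * polar_mass powr l"
      by (simp only: M_def powr_mult powr_powr q)
    moreover have "area K powr (2 - l) = (cone_mass powr 2 / cone_mass powr l) / 2 powr (2 - l)"
      unfolding area powr_divide using B by (simp only: powr_diff[of cone_mass])
    ultimately show ?thesis
      using B by (simp add: powr_mult)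
  qed
  have const: "2 powr (2 - l) * (4 * pi\<^sup>2) powr l = 2 powr (l + 2) * pi powr (2 * l)"
  proof -
    have "(4 * pi\<^sup>2) powr l = 2 powr (2 * l) * pi powr (2 * l)"
      using powr_powr[of 2 2 l] powr_powr[of pi 2 l] by (simp add: powr_mult)
    moreover have "2 powr (2 - l) * 2 powr (2 * l) = 2 powr (l + 2)"
      by (simp flip: powr_add)
    ultimately show ?thesis
      by (simp only: mult.assoc[symmetric])
  qed
  have \<Omega>M: "affine_length l K powr (2 + l) / area K powr (2 - l) \<le> M powr (2 + l) / area K powr (2 - l)"
    using \<Omega>_le \<Omega>_nonneg assms(1) by (intro divide_right_mono powr_mono2) auto
  have Mle: "M powr (2 + l) / area K powr (2 - l) \<le> 2 powr (l + 2) * pi powr (2 * l)"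
    unfolding bound const[symmetric] using blaschke_santalo(1) B T assms(1)
    by (intro mult_left_mono powr_mono2) auto
  have "centered_ellipse K"
    if "affine_length l K powr (2 + l) / area K powr (2 - l) = 2 powr (l + 2) * pi powr (2 * l)"
  proof -
    have "2 powr (2 - l) * (4 * pi\<^sup>2) powr l \<le> 2 powr (2 - l) * (cone_mass * polar_mass) powr l"
      using that \<Omega>M unfolding bound const by simp
    then have "\<not> cone_mass * polar_mass < 4 * pi\<^sup>2"
      using powr_less_mono2[of l "cone_mass * polar_mass" "4 * pi\<^sup>2"] B T assms(1) by auto
    then have "cone_mass * polar_mass = 4 * pi\<^sup>2"
      using blaschke_santalo(1) by simp
    from blaschke_santalo(2)[OF this] obtain a b k m where
      eq: "\<And>x. (support K x)\<^sup>2 = (k * sin (x - a))\<^sup>2 + (m * sin (x - b))\<^sup>2"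
      by blast
    have "compact K" "convex K" "K \<noteq> {}"
      using assms(2) interior_subset[of K] by (auto simp: K_sym_def strictly_convex_body_def)
    then show ?thesis
      using pos eq by (rule centered_ellipse_of_support)
  qed
  moreover have "affine_length l K powr (2 + l) / area K powr (2 - l) = 2 powr (l + 2) * pi powr (2 * l)"
    if "centered_ellipse K"
  proof -
    from that obtain \<alpha> \<beta> \<gamma> where
      Q: "\<And>x. (support K x)\<^sup>2 = \<alpha> * (cos x)\<^sup>2 + 2 * \<beta> * cos x * sin x + \<gamma> * (sin x)\<^sup>2"
      using centered_ellipse_support by blast
    have "affine_length l K = M"
      unfolding \<Omega> M_def by (rule holder_mass_ellipse[OF Q])
    then show ?thesis
      using bound const blaschke_santalo_ellipse[OF Q] by simp
  qed
  ultimately show ?thesis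
    using \<Omega>M Mle by linarith
qed

end
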